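(* There exists a universal covering (in the sense defined in the context) whose area is at most $0.8441153$.
   Context: For a set $A \subseteq \mathbb{R}^2$, its diameter is $\mathrm{diam}(A) = \sup\{d(x,y) : x,y \in A\}$, where $d$ is the Euclidean distance. A universal covering is a convex set $U \subseteq \mathbb{R}^2$ such that every set $A \subseteq \mathbb{R}^2$ with $\mathrm{diam}(A) = 1$ is isometric to some subset $B \subseteq U$. Here isometric means related by a Euclidean isometry of the plane, i.e. a composition of translations, rotations and reflections. Area means Lebesgue measure in $\mathbb{R}^2$. *)

theory Defs
  imports "HOL-Analysis.Analysis"
begin

text \<open>Diameter as a supremum in the extended reals (so an unbounded set has diameter \<infinity>).\<close>
definition diam :: "(real^2) set \<Rightarrow> ereal" where
  "diam A = (SUP p \<in> A \<times> A. ereal (dist (fst p) (snd p)))"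

definition plane_isometry :: "(real^2 \<Rightarrow> real^2) \<Rightarrow> bool" where
  "plane_isometry f \<longleftrightarrow> bij f \<and> (\<forall>x y. dist (f x) (f y) = dist x y)"

definition universal_covering :: "(real^2) set \<Rightarrow> bool" where
  "universal_covering U \<longleftrightarrow> convex U \<and>
     (\<forall>A. diam A = 1 \<longrightarrow> (\<exists>f. plane_isometry f \<and> f ` A \<subseteq> U))"

end

theory Submission
  imports Defs
begin

text \<open>
  A set of diameter 1 lies in a body \<open>K\<close> of constant width 1, and \<open>K\<close> has a circumscribed regular
  hexagon \<open>ABCDEF\<close> (labelled counterclockwise) of width 1. Fix a small slant \<open>s\<close>. For a corner \<open>X\<close> in
  direction \<open>\<theta>\<close> let \<open>X+\<close> and \<open>X-\<close> be the triangles cut off at \<open>X\<close> by the lines at distance \<open>1/2\<close> from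
  the centre with normal direction \<open>\<theta> + s\<close> and \<open>\<theta> - s\<close>. The lines of opposite corners are at distance
  1, so \<open>K\<close> enters at most one of two opposite \<open>X+\<close>, and likewise for \<open>X-\<close>.

  As in Pal's argument one may rotate so that \<open>K\<close> avoids \<open>C+\<close> and \<open>E+\<close>. Then \<open>K\<close> avoids \<open>A-\<close>, or it
  avoids \<open>E-\<close>, or it avoids both \<open>B-\<close> and \<open>D-\<close>. In the last case the reflection that exchanges
  \<open>B, E\<close> and \<open>C, D\<close> preserves the assumptions, so the contact point of \<open>K\<close> with \<open>CD\<close> may be taken in
  the half next to \<open>D\<close>. Since \<open>K\<close> lies in the unit disc about each of its points, the avoided triangles
  bound the contact points with \<open>CD\<close> and \<open>DE\<close> away from \<open>C\<close> and \<open>E\<close>, and this cuts off a region near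
  \<open>A\<close>. The cover is a polygon circumscribed about what remains.
\<close>

section \<open>Completion to constant width\<close>

text \<open>Constant width 1 expressed by chords: with the diameter bound, the chord from
  \<open>p\<close> to \<open>p + n\<close> confines the set to the strip bounded by its end
  points.\<close>

definition unit_width :: "(real^2) set \<Rightarrow> bool" where
  "unit_width K \<longleftrightarrow> (\<forall>x\<in>K. \<forall>y\<in>K. dist x y \<le> 1) \<and> (\<forall>n. norm n = 1 \<longrightarrow> (\<exists>p\<in>K. p + n \<in> K))"

text \<open>Zorn's lemma applies because two points of the union of a chain already lie in a common
  member; a point within distance 1 of all of \<open>K\<close> could be added to
  \<open>K\<close>.\<close>

lemma maximal_diameter_one_extension:
  fixes A :: "'a::metric_space set"
  assumes "\<forall>x\<in>A. \<forall>y\<in>A. dist x y \<le> 1"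
  obtains K where "A \<subseteq> K" "\<forall>x\<in>K. \<forall>y\<in>K. dist x y \<le> 1" "\<And>z. \<forall>x\<in>K. dist x z \<le> 1 \<Longrightarrow> z \<in> K"
proof -
  define \<A> where "\<A> = {K. A \<subseteq> K \<and> (\<forall>x\<in>K. \<forall>y\<in>K. dist x y \<le> 1)}"
  have "A \<in> \<A>" using assms by (auto simp: \<A>_def)
  then have "\<A> \<noteq> {}" by auto
  moreover have "\<Union>\<C> \<in> \<A>" if "\<C> \<noteq> {}" "subset.chain \<A> \<C>" for \<C>
  proof -
    have sub: "\<C> \<subseteq> \<A>" and lin: "\<forall>X\<in>\<C>. \<forall>Y\<in>\<C>. X \<subseteq> Y \<or> Y \<subseteq> X"
      using that(2) by (auto simp: subset_chain_def)
    have "dist x y \<le> 1" if xy: "x \<in> \<Union>\<C>" "y \<in> \<Union>\<C>" for x y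
    proof -
      obtain X Y where XY: "X \<in> \<C>" "Y \<in> \<C>" "x \<in> X" "y \<in> Y" using xy by (meson UnionE)
      with lin obtain Z where "Z \<in> \<C>" "x \<in> Z" "y \<in> Z" by blast
      with sub show ?thesis by (auto simp: \<A>_def)
    qed
    moreover have "A \<subseteq> \<Union>\<C>" using \<open>\<C> \<noteq> {}\<close> sub by (auto simp: \<A>_def)
    ultimately show ?thesis by (auto simp: \<A>_def)
  qed
  ultimately obtain K where K: "K \<in> \<A>" "\<forall>X\<in>\<A>. K \<subseteq> X \<longrightarrow> X = K"
    using subset_Zorn_nonempty[of \<A>] by auto
  show thesis
  proof
    show "A \<subseteq> K" "\<forall>x\<in>K. \<forall>y\<in>K. dist x y \<le> 1" using K(1) by (auto simp: \<A>_def)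
    fix z assume z: "\<forall>x\<in>K. dist x z \<le> 1"
    then have "insert z K \<in> \<A>" using K(1) by (auto simp: \<A>_def dist_commute)
    then show "z \<in> K" using K(2) by auto
  qed
qed

lemma orthonormal_expand:
  fixes n t w :: "real^2"
  assumes "norm n = 1" "norm t = 1" "n \<bullet> t = 0"
  shows "w = (w \<bullet> n) *\<^sub>R n + (w \<bullet> t) *\<^sub>R t"
proof -
  have 1: "n$1 * n$1 + n$2 * n$2 = 1" "t$1 * t$1 + t$2 * t$2 = 1" "n$1 * t$1 + n$2 * t$2 = 0"
    using assms by (auto simp: norm_eq_1 inner_vec_def sum_2)
  have 2: "t$1 * t$1 + n$1 * n$1 = 1" "t$2 * t$2 + n$2 * n$2 = 1" "t$1 * t$2 + n$1 * n$2 = 0"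
    using 1 by algebra+
  show ?thesis
    by (simp add: vec_eq_iff forall_2 inner_vec_def sum_2) (use 2 in algebra)
qed

text \<open>Every unit disc containing the ends of a short unit arc contains the whole arc.\<close>
lemma short_arc_in_disc:
  fixes n t a b w :: "real^2"
  assumes n: "norm n = 1" "norm t = 1" "n \<bullet> t = 0"
    and a: "norm a = 1" "a \<bullet> n \<ge> 0" "a \<bullet> t \<ge> 0"
    and b: "norm b = 1" "b \<bullet> n \<ge> 0" "b \<bullet> t \<le> 0"
    and ab: "dist a b \<le> 1"
    and w: "norm (w - a) \<le> 1" "norm (w - b) \<le> 1"
  shows "norm (w - n) \<le> 1"
proof -
  have half: "norm (w - y) \<le> 1 \<longleftrightarrow> w \<bullet> w \<le> 2 * (w \<bullet> y)" if "norm y = 1" for y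
  proof -
    have "norm (w - y) \<le> 1 \<longleftrightarrow> (w - y) \<bullet> (w - y) \<le> 1" by (simp add: norm_le_square)
    then show ?thesis using that by (simp add: inner_diff inner_commute norm_eq_1)
  qed
  have nn: "n \<bullet> n = 1" "t \<bullet> t = 1" using n by (auto simp: norm_eq_1)
  define a1 a2 b1 b2 where d: "a1 = a \<bullet> n" "a2 = a \<bullet> t" "b1 = b \<bullet> n" "b2 = b \<bullet> t"
  have a': "a = a1 *\<^sub>R n + a2 *\<^sub>R t" and b': "b = b1 *\<^sub>R n + b2 *\<^sub>R t"
    using orthonormal_expand[OF n] d by auto
  have sa: "a1\<^sup>2 + a2\<^sup>2 = 1" using a(1) n(3) nn
    unfolding norm_eq_1 a' by (simp add: inner_add inner_commute power2_eq_square)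
  have sb: "b1\<^sup>2 + b2\<^sup>2 = 1" using b(1) n(3) nn
    unfolding norm_eq_1 b' by (simp add: inner_add inner_commute power2_eq_square)
  have sgn: "a1 \<ge> 0" "a2 \<ge> 0" "b1 \<ge> 0" "b2 \<le> 0" using a b d by auto
  have "(a - b) \<bullet> (a - b) \<le> 1" using ab by (simp add: dist_norm norm_le_square)
  then have "2 * (a \<bullet> b) \<ge> 1" using a(1) b(1) by (simp add: inner_diff inner_commute norm_eq_1)
  moreover have "a \<bullet> b = a1 * b1 + a2 * b2"
    unfolding a' b' using n(3) nn by (simp add: inner_add inner_commute)
  ultimately have "a1 * b1 + a2 * b2 > 0" by simp
  moreover have "a2 * b2 \<le> 0" using sgn by (simp add: mult_nonneg_nonpos)
  ultimately have pos: "a1 > 0" "b1 > 0" using sgn by (smt (verit) mult_eq_0_iff)+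
  have wa: "w \<bullet> w \<le> 2 * (a1 * (w \<bullet> n) + a2 * (w \<bullet> t))"
    using w(1) half[OF a(1)] unfolding a' by (simp add: inner_add_right)
  have wb: "w \<bullet> w \<le> 2 * (b1 * (w \<bullet> n) + b2 * (w \<bullet> t))"
    using w(2) half[OF b(1)] unfolding b' by (simp add: inner_add_right)
  define N T where NT: "N = w \<bullet> n" "T = w \<bullet> t"
  have le1: "a1 \<le> 1" "b1 \<le> 1" using sa sb by (smt (verit) power2_le_imp_le power_one zero_le_power2)+
  have ww: "w \<bullet> w \<ge> 0" by simp
  \<comment> \<open>On the side \<open>T \<le> 0\<close> the disc about \<open>a\<close> gives the
    bound, since there the \<open>t\<close>-part of \<open>a\<close> contributes nothing positive;
    on the other side the disc about \<open>b\<close> does.\<close>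
  have "w \<bullet> w \<le> 2 * N"
  proof (cases "T \<le> 0")
    case True
    have "w \<bullet> w \<le> 2 * (a1 * N)"
      using wa True sgn mult_nonneg_nonpos[of a2 T] by (simp add: NT)
    moreover from this have "N \<ge> 0" using ww pos by (smt (verit) mult_pos_neg)
    then have "a1 * N \<le> N" using le1 pos by (simp add: mult_left_le_one_le)
    ultimately show ?thesis by linarith
  next
    case False
    have "w \<bullet> w \<le> 2 * (b1 * N)"
      using wb False sgn mult_nonneg_nonpos[of T b2] by (simp add: NT mult.commute)
    moreover from this have "N \<ge> 0" using ww pos by (smt (verit) mult_pos_neg)
    then have "b1 * N \<le> N" using le1 pos by (simp add: mult_left_le_one_le)
    ultimately show ?thesis by linarith
  qed
  then show ?thesis using half[OF n(1)] by (simp add: NT)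
qed

text \<open>At a lowest point \<open>p\<close> of a maximal \<open>K\<close> in direction
  \<open>n\<close> there are points of \<open>K\<close> at distance 1 from \<open>p\<close> on both
  sides of the normal. They span a short arc about \<open>p\<close> through \<open>p + n\<close>, so
  \<open>K\<close> lies in the unit disc about \<open>p + n\<close>, and maximality puts
  \<open>p + n\<close> into \<open>K\<close>.\<close>

lemma unit_width_extension:
  fixes A :: "(real^2) set"
  assumes "\<forall>x\<in>A. \<forall>y\<in>A. dist x y \<le> 1" "A \<noteq> {}"
  obtains K where "A \<subseteq> K" "unit_width K"
proof -
  obtain K where K: "A \<subseteq> K" "\<forall>x\<in>K. \<forall>y\<in>K. dist x y \<le> 1"
    and mx: "\<And>z. \<forall>x\<in>K. dist x z \<le> 1 \<Longrightarrow> z \<in> K"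
    using maximal_diameter_one_extension[OF assms(1)] by metis
  have ne: "K \<noteq> {}" using K assms by auto
  have "K = (\<Inter>x\<in>K. cball x 1)" using K(2) mx by auto
  then have "closed K" by (metis closed_INT closed_cball)
  moreover have "bounded K" using ne K(2) unfolding bounded_def by blast
  ultimately have cpt: "compact K" using compact_eq_bounded_closed by auto
  have "\<exists>p\<in>K. p + n \<in> K" if n: "norm n = 1" for n
  proof -
    obtain p where p: "p \<in> K" "\<forall>x\<in>K. p \<bullet> n \<le> x \<bullet> n"
      using continuous_attains_inf[OF cpt ne continuous_on_inner[OF continuous_on_id continuous_on_const], of n] by auto
    have nn: "n \<bullet> n = 1" using n by (simp add: norm_eq_1)
    \<comment> \<open>points slightly below \<open>p\<close> are not in \<open>K\<close>, so by maximality some point of \<open>K\<close> is far from them\<close>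
    have key: "\<exists>x\<in>K. norm (x - p) = 1 \<and> (x - p) \<bullet> n \<ge> 0 \<and> (x - p) \<bullet> t \<ge> 0"
      if t: "norm t = 1" "n \<bullet> t = 0" for t
    proof -
      have tt: "t \<bullet> t = 1" using t by (simp add: norm_eq_1)
      \<comment> \<open>\<open>g x \<ge> 0\<close> encodes both demands on \<open>x\<close>. As
        \<open>g\<close> attains its maximum on \<open>K\<close>, points with \<open>g\<close>
        arbitrarily close to 0 suffice.\<close>
      define g where "g x = min ((x - p) \<bullet> t) (norm (x - p) - 1)" for x
      have "continuous_on K g" unfolding g_def by (intro continuous_intros)
      then obtain x where x: "x \<in> K" "\<forall>y\<in>K. g y \<le> g x"
        using continuous_attains_sup[OF cpt ne] by metis
      have "g x \<ge> - (2 * e)" if e: "0 < e" "e \<le> 1" for e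
      proof -
        \<comment> \<open>The second-order shift along \<open>n\<close> already takes
          \<open>p - v\<close> out of \<open>K\<close>; the first-order shift along \<open>t\<close>
          dominates and forces the far point \<open>y\<close> onto the side of \<open>t\<close>, up
          to an error of order \<open>e\<close>.\<close>
        define v where "v = e *\<^sub>R t + (e * e) *\<^sub>R n"
        have "(p - v) \<bullet> n < p \<bullet> n"
          using e t nn by (simp add: v_def inner_diff inner_add inner_commute)
        then have "p - v \<notin> K" using p by force
        then obtain y where y: "y \<in> K" "dist y (p - v) > 1" using mx by force
        have nv: "norm v \<le> 2 * e"
        proof -
          have "norm v \<le> \<bar>e\<bar> + \<bar>e * e\<bar>" unfolding v_def
            by (rule order_trans[OF norm_triangle_ineq]) (simp add: t n)
          also have "\<dots> \<le> 2 * e" using e by (simp add: mult_left_le)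
          finally show ?thesis .
        qed
        have e1: "1 < norm (y - p + v)" using y(2) by (simp add: dist_norm algebra_simps)
        have le1: "norm (y - p) \<le> 1" using K(2) y(1) p(1) by (metis dist_norm)
        have "norm (y - p) - 1 \<ge> - (2 * e)"
          using e1 nv norm_triangle_ineq[of "y - p" v] by linarith
        moreover have "(y - p) \<bullet> t \<ge> - (2 * e)"
        proof -
          have "1 < (y - p + v) \<bullet> (y - p + v)" using e1 by (simp add: norm_gt_square)
          moreover have "(y - p) \<bullet> (y - p) \<le> 1" using le1 by (simp add: norm_le_square)
          ultimately have "0 < 2 * ((y - p) \<bullet> v) + v \<bullet> v"
            by (simp add: inner_add inner_commute)
          moreover have "v \<bullet> v = e * e + (e * e) * (e * e)"
            using t nn tt by (simp add: v_def inner_add inner_commute)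
          moreover have "(y - p) \<bullet> v = e * ((y - p) \<bullet> t) + (e * e) * ((y - p) \<bullet> n)"
            by (simp add: v_def inner_add_right)
          ultimately have "0 < e * (2 * ((y - p) \<bullet> t) + 2 * (e * ((y - p) \<bullet> n)) + e + e * (e * e))"
            by (simp add: algebra_simps)
          then have "0 < 2 * ((y - p) \<bullet> t) + 2 * (e * ((y - p) \<bullet> n)) + e + e * (e * e)"
            using e(1) zero_less_mult_pos by blast
          moreover have "(y - p) \<bullet> n \<le> 1"
            using norm_cauchy_schwarz[of "y - p" n] le1 n by simp
          then have "e * ((y - p) \<bullet> n) \<le> e" using e mult_left_le by simp
          moreover have "e * (e * e) \<le> e" using e by (simp add: mult_left_le mult_le_one)
          ultimately show ?thesis by linarith
        qed
        ultimately have "g y \<ge> - (2 * e)" by (simp add: g_def)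
        then show ?thesis using x y(1) by force
      qed
      then have "g x \<ge> - (2 * min 1 (- g x / 4))" if "g x < 0" using that by simp
      then have "g x \<ge> 0" by (cases "g x < 0") (auto simp: min_def split: if_splits)
      then have "(x - p) \<bullet> t \<ge> 0" "norm (x - p) \<ge> 1" by (auto simp: g_def)
      moreover have "norm (x - p) \<le> 1" using K(2) x(1) p(1) by (metis dist_norm)
      moreover have "(x - p) \<bullet> n \<ge> 0" using p x(1) by (simp add: inner_diff_left)
      ultimately show ?thesis using x(1) by force
    qed
    define t :: "real^2" where "t = vector [- n$2, n$1]"
    have "t \<bullet> t = 1" "n \<bullet> t = 0" using nn by (auto simp: t_def inner_vec_def sum_2)
    then have t: "norm t = 1" "n \<bullet> t = 0" "norm (- t) = 1" "n \<bullet> - t = 0" by (auto simp: norm_eq_1)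
    obtain x where x: "x \<in> K" "norm (x - p) = 1" "(x - p) \<bullet> n \<ge> 0" "(x - p) \<bullet> t \<ge> 0"
      using key[OF t(1,2)] by auto
    obtain y where y: "y \<in> K" "norm (y - p) = 1" "(y - p) \<bullet> n \<ge> 0" "(y - p) \<bullet> t \<le> 0"
      using key[OF t(3,4)] by auto
    have "dist (x - p) (y - p) \<le> 1" using K(2) x(1) y(1) by (simp add: dist_norm)
    then have "norm ((z - p) - n) \<le> 1" if "z \<in> K" for z
      using short_arc_in_disc[OF n t(1,2) x(2-4) y(2-4), of "z - p"] K(2) that x(1) y(1)
      by (simp add: dist_norm)
    then have "p + n \<in> K" by (intro mx) (simp add: dist_norm algebra_simps)
    then show ?thesis using p by auto
  qed
  then have "unit_width K" using K(2) by (auto simp: unit_width_def)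
  with that K(1) show thesis by blast
qed

section \<open>The circumscribed regular hexagon\<close>

lemma unit_width_strip:
  assumes "unit_width K" "norm n = 1"
  obtains p where "p \<in> K" "p + n \<in> K" "\<And>x. x \<in> K \<Longrightarrow> p \<bullet> n \<le> x \<bullet> n \<and> x \<bullet> n \<le> p \<bullet> n + 1"
proof -
  have d: "norm (x - y) \<le> 1" if "x \<in> K" "y \<in> K" for x y
    using assms(1) that by (auto simp: unit_width_def dist_norm)
  obtain p where p: "p \<in> K" "p + n \<in> K" using assms by (auto simp: unit_width_def)
  have nn: "n \<bullet> n = 1" using assms by (simp add: norm_eq_1)
  have cs: "y \<bullet> n \<le> 1" if "norm y \<le> 1" for y
    using norm_cauchy_schwarz[of y n] assms(2) that by simp
  show thesis
  proof (rule that[OF p])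
    fix x assume "x \<in> K"
    then have "(x - p) \<bullet> n \<le> 1" "(p + n - x) \<bullet> n \<le> 1" using d p cs by blast+
    then show "p \<bullet> n \<le> x \<bullet> n \<and> x \<bullet> n \<le> p \<bullet> n + 1"
      using nn by (simp add: inner_diff_left inner_add_left)
  qed
qed

lemma unit_width_image:
  assumes "unit_width K" "orthogonal_transformation R"
  shows "unit_width ((\<lambda>x. R (x - z)) ` K)"
proof -
  have lin: "linear R" and iso: "norm (R v) = norm v" for v
    using assms(2) orthogonal_transformation_norm by (auto simp: orthogonal_transformation_def)
  have d: "dist (R (x - z)) (R (y - z)) = dist x y" for x y
    unfolding dist_norm by (simp add: iso flip: linear_diff[OF lin])
  have "\<exists>p\<in>(\<lambda>x. R (x - z)) ` K. p + n \<in> (\<lambda>x. R (x - z)) ` K" if "norm n = 1" for n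
  proof -
    obtain m where m: "n = R m" using orthogonal_transformation_surj[OF assms(2)] by (metis surjD)
    then have "norm m = 1" using that iso by simp
    then obtain p where p: "p \<in> K" "p + m \<in> K" using assms(1) by (auto simp: unit_width_def)
    have "R (p - z) + n = R (p + m - z)" unfolding m
      by (simp add: algebra_simps flip: linear_add[OF lin])
    then show ?thesis using p by (metis imageI)
  qed
  then show ?thesis using assms(1) d by (auto simp: unit_width_def)
qed

lemma plane_isometry_rigid:
  assumes "orthogonal_transformation R"
  shows "plane_isometry (\<lambda>x. R (x - z))"
proof -
  have lin: "linear R" and iso: "norm (R v) = norm v" for v
    using assms orthogonal_transformation_norm by (auto simp: orthogonal_transformation_def)
  have "dist (R (x - z)) (R (y - z)) = dist x y" for x y
    unfolding dist_norm by (simp add: iso flip: linear_diff[OF lin])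
  moreover have "bij (\<lambda>x. x - z)" by (rule bij_betwI[where g = "\<lambda>x. x + z"]) auto
  then have "bij (R \<circ> (\<lambda>x. x - z))"
    using orthogonal_transformation_bij[OF assms] by (rule bij_comp)
  ultimately show ?thesis by (simp add: plane_isometry_def comp_def)
qed

lemma plane_isometry_comp:
  "plane_isometry f \<Longrightarrow> plane_isometry g \<Longrightarrow> plane_isometry (f \<circ> g)"
  by (auto simp: plane_isometry_def bij_comp)

definition regular_hexagon :: "(real^2) set" where
  "regular_hexagon = {x. \<bar>x$1\<bar> \<le> 1/2 \<and> \<bar>x$1 + sqrt 3 * x$2\<bar> \<le> 1 \<and> \<bar>x$1 - sqrt 3 * x$2\<bar> \<le> 1}"

lemma orthogonal_transformationI_vec2:
  fixes f :: "real^2 \<Rightarrow> real^2"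
  assumes "linear f" "\<And>x. (f x $ 1)\<^sup>2 + (f x $ 2)\<^sup>2 = (x$1)\<^sup>2 + (x$2)\<^sup>2"
  shows "orthogonal_transformation f"
  unfolding orthogonal_transformation using assms
  by (simp add: norm_vec_def L2_set_def sum_2)

text \<open>The strips of width 1 in three directions 60 degrees apart have centre lines at offsets
  \<open>c0\<close>, \<open>c1\<close>, \<open>c2\<close>. These lines are concurrent iff
  \<open>c0 - c1 + c2 = 0\<close>, because
  \<open>N (\<theta> + 2*pi/3) = N (\<theta> + pi/3) - N \<theta>\<close>. The defect
  \<open>F\<close> changes sign under rotation by 60 degrees, hence vanishes somewhere.\<close>

lemma circumscribed_regular_hexagon:
  assumes K: "unit_width K"
  obtains R z where "orthogonal_transformation R" "(\<lambda>x. R (x - z)) ` K \<subseteq> regular_hexagon"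
proof -
  define N :: "real \<Rightarrow> real^2" where "N \<theta> = cos \<theta> *\<^sub>R axis 1 1 + sin \<theta> *\<^sub>R axis 2 1" for \<theta>
  define H where "H n = (SUP x\<in>K. x \<bullet> n)" for n
  have N12: "N \<theta> $ 1 = cos \<theta>" "N \<theta> $ 2 = sin \<theta>" for \<theta> by (auto simp: N_def axis_def)
  have N1: "norm (N \<theta>) = 1" for \<theta> by (simp add: N12 norm_vec_def L2_set_def sum_2)
  have bnd: "x \<bullet> n \<le> H n \<and> H n - 1 \<le> x \<bullet> n" "\<exists>q\<in>K. H n = q \<bullet> n" "H (- n) = 1 - H n"
    if n: "norm n = 1" and x: "x \<in> K" for n x
  proof -
    obtain p where p: "p \<in> K" "p + n \<in> K" "\<And>x. x \<in> K \<Longrightarrow> p \<bullet> n \<le> x \<bullet> n \<and> x \<bullet> n \<le> p \<bullet> n + 1"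
      using unit_width_strip[OF K n] by metis
    have nn: "n \<bullet> n = 1" using n by (simp add: norm_eq_1)
    have q: "(p + n) \<bullet> n = p \<bullet> n + 1" by (simp add: inner_add_left nn)
    have H: "H n = p \<bullet> n + 1" unfolding H_def
      by (rule cSup_eq_maximum) (use p q in \<open>auto intro!: image_eqI[where x = "p + n"]\<close>)
    moreover have "H (- n) = - (p \<bullet> n)" unfolding H_def
      by (rule cSup_eq_maximum) (use p in \<open>auto intro!: image_eqI[where x = p]\<close>)
    ultimately show "x \<bullet> n \<le> H n \<and> H n - 1 \<le> x \<bullet> n" "\<exists>q\<in>K. H n = q \<bullet> n" "H (- n) = 1 - H n"
      using p q x by (auto intro!: bexI[of _ "p + n"])
  qed
  obtain x0 where x0: "x0 \<in> K" using K norm_axis_1 unfolding unit_width_def by metis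
  define B where "B = norm x0 + 1"
  have B: "norm x \<le> B" if "x \<in> K" for x
  proof -
    have "dist x x0 \<le> 1" using K x0 that by (auto simp: unit_width_def)
    then show ?thesis using norm_triangle_sub[of x x0] by (simp add: B_def dist_norm)
  qed
  have "B-lipschitz_on (sphere 0 1) H"
  proof (rule lipschitz_onI)
    have le: "H n - H m \<le> B * dist n m" if nm: "norm n = 1" "norm m = 1" for n m
    proof -
      obtain q where q: "q \<in> K" "H n = q \<bullet> n" using bnd(2)[OF nm(1) x0] by auto
      have "H n = q \<bullet> m + q \<bullet> (n - m)" using q by (simp add: inner_diff_right)
      also have "q \<bullet> m \<le> H m" using bnd(1)[OF nm(2) q(1)] by simp
      also have "q \<bullet> (n - m) \<le> norm q * norm (n - m)" by (rule norm_cauchy_schwarz)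
      also have "\<dots> \<le> B * dist n m" using B[OF q(1)] by (simp add: dist_norm mult_right_mono)
      finally show ?thesis by simp
    qed
    fix n m :: "real^2" assume "n \<in> sphere 0 1" "m \<in> sphere 0 1"
    then show "dist (H n) (H m) \<le> B * dist n m"
      using le[of n m] le[of m n] by (auto simp: dist_real_def dist_commute abs_le_iff)
  qed (simp add: B_def)
  then have cH: "continuous_on (sphere 0 1) H" by (rule lipschitz_on_continuous_on)
  have cN: "continuous_on UNIV (\<lambda>\<theta>. H (N (\<theta> + a)))" for a
    by (rule continuous_on_compose2[OF cH]) (auto simp: N_def[abs_def] N1[unfolded N_def] intro!: continuous_intros)
  define F where "F \<theta> = H (N (\<theta> + 0)) - H (N (\<theta> + pi/3)) + H (N (\<theta> + 2*pi/3)) - 1/2" for \<theta>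
  have "N (pi/3 + 2*pi/3) = - N 0" by (simp add: N_def field_simps)
  then have anti: "F (pi/3) = - F 0"
    using bnd(3)[OF N1 x0, of 0] by (simp add: F_def field_simps)
  have "continuous_on {0..pi/3} F" unfolding F_def
    by (intro continuous_intros continuous_on_subset[OF cN]) auto
  then have "\<exists>\<theta>. F \<theta> = 0"
    using IVT'[of F 0 0 "pi/3"] IVT2'[of F "pi/3" 0 0] anti by (cases "F 0 \<le> 0") force+
  then obtain \<theta> where F0: "F \<theta> = 0" by auto
  define c0 c1 c2 where c: "c0 = H (N \<theta>) - 1/2" "c1 = H (N (\<theta> + pi/3)) - 1/2" "c2 = H (N (\<theta> + 2*pi/3)) - 1/2"
  have cc: "c2 = c1 - c0" using F0 by (simp add: F_def c)
  define T where "T = N (\<theta> + pi/2)"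
  define R :: "real^2 \<Rightarrow> real^2" where "R x = vector [x \<bullet> N \<theta>, x \<bullet> T]" for x
  \<comment> \<open>The common point of the three centre lines.\<close>
  define z where "z = c0 *\<^sub>R N \<theta> + ((2 * c1 - c0) / sqrt 3) *\<^sub>R T"
  have T12: "T $ 1 = - sin \<theta>" "T $ 2 = cos \<theta>" by (auto simp: T_def N12 cos_add sin_add)
  have e1: "N (\<theta> + pi/3) = (1/2) *\<^sub>R N \<theta> + (sqrt 3 / 2) *\<^sub>R T"
    by (simp add: vec_eq_iff forall_2 N12 T12 cos_add sin_add cos_60 sin_60)
  have e2: "N (\<theta> + 2*pi/3) = - (1/2) *\<^sub>R N \<theta> + (sqrt 3 / 2) *\<^sub>R T"
    by (simp add: vec_eq_iff forall_2 N12 T12 cos_add sin_add cos_120 sin_120)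
  have on: "N \<theta> \<bullet> N \<theta> = 1" "T \<bullet> T = 1" "N \<theta> \<bullet> T = 0" "T \<bullet> N \<theta> = 0"
    using N1 by (auto simp: T_def norm_eq_1) (auto simp: inner_vec_def sum_2 N12 cos_add sin_add)
  have z: "z \<bullet> N \<theta> = c0" "sqrt 3 * (z \<bullet> T) = 2 * c1 - c0"
    using on by (auto simp: z_def inner_add_left)
  have orth: "orthogonal_transformation R"
  proof (rule orthogonal_transformationI_vec2)
    show "linear R"
      by (rule linearI) (auto simp: R_def vec_eq_iff forall_2 inner_add_left)
    fix x
    have "(sin \<theta>)\<^sup>2 + (cos \<theta>)\<^sup>2 = 1" by simp
    then show "(R x $ 1)\<^sup>2 + (R x $ 2)\<^sup>2 = (x$1)\<^sup>2 + (x$2)\<^sup>2"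
      unfolding R_def vector_2 inner_vec_def sum_2 N12 T12 inner_real_def by algebra
  qed
  have "R (x - z) \<in> regular_hexagon" if x: "x \<in> K" for x
  proof -
    define p q where pq: "p = x \<bullet> N \<theta>" "q = sqrt 3 * (x \<bullet> T)"
    have "p \<le> c0 + 1/2 \<and> c0 - 1/2 \<le> p" using bnd(1)[OF N1 x, of \<theta>] by (auto simp: pq c)
    moreover have "p + q \<le> 2 * c1 + 1 \<and> 2 * c1 - 1 \<le> p + q"
      using bnd(1)[OF N1 x, of "\<theta> + pi/3"] unfolding e1
      by (simp add: pq c(2) e1 inner_add_right)
    moreover have "q - p \<le> 2 * c2 + 1 \<and> 2 * c2 - 1 \<le> q - p"
      using bnd(1)[OF N1 x, of "\<theta> + 2*pi/3"] unfolding e2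
      by (simp add: pq c(3) e2 inner_diff_right)
    moreover have "R (x - z) $ 1 = p - c0" "sqrt 3 * R (x - z) $ 2 = q - (2 * c1 - c0)"
      using z by (auto simp: R_def pq inner_diff_left right_diff_distrib)
    ultimately show ?thesis
      unfolding regular_hexagon_def mem_Collect_eq cc abs_le_iff by argo
  qed
  then show thesis using that[OF orth, of z] by blast
qed

section \<open>Placement in the hexagon\<close>

text \<open>The factor \<open>sqrt 3\<close> makes the sides of the hexagon and all cutting lines
  rational.\<close>

definition lin :: "real \<Rightarrow> real \<Rightarrow> real^2 \<Rightarrow> real" where
  "lin a b x = a * x$1 + b * (sqrt 3 * x$2)"

lemma lin_eq_inner: "lin a b x = x \<bullet> vector [a, sqrt 3 * b]"
  by (simp add: lin_def inner_vec_def sum_2 algebra_simps)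

lemma norm_lin_vector: "norm (vector [a, sqrt 3 * b] :: real^2) = sqrt (a\<^sup>2 + 3 * b\<^sup>2)"
  by (simp add: norm_vec_def L2_set_def sum_2 power_mult_distrib)

lemma lin_uminus: "lin (- a) (- b) x = - lin a b x"
  by (simp add: lin_def)

lemma lin_le_add_norm:
  assumes "dist x q \<le> 1"
  shows "lin a b x \<le> lin a b q + sqrt (a\<^sup>2 + 3 * b\<^sup>2)"
proof -
  have "lin a b x - lin a b q = (x - q) \<bullet> vector [a, sqrt 3 * b]"
    by (simp add: lin_eq_inner inner_diff_left)
  also have "\<dots> \<le> norm (x - q) * sqrt (a\<^sup>2 + 3 * b\<^sup>2)"
    by (metis norm_cauchy_schwarz norm_lin_vector)
  also have "\<dots> \<le> sqrt (a\<^sup>2 + 3 * b\<^sup>2)"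
    using assms by (intro mult_left_le_one_le) (auto simp: dist_norm)
  finally show ?thesis by simp
qed

text \<open>In the scale of \<open>lin a b\<close> the set fills a strip of width \<open>r\<close>,
  at most the gap \<open>2 * c\<close> between the two parallel lines, so it cannot cross
  both.\<close>

lemma unit_width_avoids_side:
  assumes K: "unit_width K" and "a\<^sup>2 + 3 * b\<^sup>2 \<le> (2 * c)\<^sup>2" "c \<ge> 0" "a\<^sup>2 + 3 * b\<^sup>2 > 0"
  shows "(\<forall>x\<in>K. lin a b x \<le> c) \<or> (\<forall>x\<in>K. lin (- a) (- b) x \<le> c)"
proof -
  define r where "r = sqrt (a\<^sup>2 + 3 * b\<^sup>2)"
  define v :: "real^2" where "v = vector [a, sqrt 3 * b]"
  have r: "r > 0" "r \<le> 2 * c" using assms by (auto simp: r_def intro: real_le_lsqrt)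
  have "norm ((1/r) *\<^sub>R v) = 1" using r norm_lin_vector[of a b] by (simp add: v_def r_def)
  then obtain p where p: "p \<in> K" "\<And>x. x \<in> K \<Longrightarrow>
      p \<bullet> ((1/r) *\<^sub>R v) \<le> x \<bullet> ((1/r) *\<^sub>R v) \<and> x \<bullet> ((1/r) *\<^sub>R v) \<le> p \<bullet> ((1/r) *\<^sub>R v) + 1"
    using unit_width_strip[OF K] by metis
  have l: "lin a b x = x \<bullet> v" for x by (simp add: lin_eq_inner v_def)
  have q: "lin a b p \<le> lin a b x \<and> lin a b x \<le> lin a b p + r" if "x \<in> K" for x
    using p(2)[OF that] r by (simp add: l field_simps)
  show ?thesis
  proof (cases "lin a b p + r \<le> c")
    case True
    then show ?thesis using q by force
  next
    case False
    then have "- lin a b x \<le> c" if "x \<in> K" for x using q[OF that] r by linarith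
    then show ?thesis by (simp add: lin_uminus)
  qed
qed

section \<open>Symmetries of the hexagon\<close>

definition rot60 :: "real^2 \<Rightarrow> real^2" where
  "rot60 x = vector [x$1 / 2 - sqrt 3 / 2 * x$2, sqrt 3 / 2 * x$1 + x$2 / 2]"

definition flip :: "real^2 \<Rightarrow> real^2" where
  "flip x = vector [x$1, - x$2]"

lemma sqrt3_mult: "sqrt 3 * (sqrt 3 * (x::real)) = 3 * x"
  by (simp flip: mult.assoc)

lemma lin_rot60: "lin a b (rot60 x) = lin ((a + 3 * b) / 2) ((b - a) / 2) x"
  by (simp add: lin_def rot60_def field_simps sqrt3_mult)

lemma lin_flip: "lin a b (flip x) = lin a (- b) x"
  by (simp add: lin_def flip_def)

lemma orthogonal_rot60: "orthogonal_transformation rot60"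
proof (rule orthogonal_transformationI_vec2)
  show "linear rot60"
    by (rule linearI) (auto simp: rot60_def vec_eq_iff forall_2 algebra_simps add_divide_distrib)
  fix x
  have "(sqrt 3)\<^sup>2 = (3::real)" by simp
  then show "(rot60 x $ 1)\<^sup>2 + (rot60 x $ 2)\<^sup>2 = (x$1)\<^sup>2 + (x$2)\<^sup>2"
    unfolding rot60_def vector_2 by (simp add: power2_sum power2_diff power_mult_distrib power_divide field_simps)
qed

lemma orthogonal_flip: "orthogonal_transformation flip"
  by (rule orthogonal_transformationI_vec2)
     (auto intro!: linearI simp: flip_def vec_eq_iff forall_2)

lemma regular_hexagon_lin:
  "regular_hexagon = {x. \<bar>lin 1 0 x\<bar> \<le> 1/2 \<and> \<bar>lin 1 1 x\<bar> \<le> 1 \<and> \<bar>lin 1 (-1) x\<bar> \<le> 1}"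
  by (auto simp: regular_hexagon_def lin_def)

lemma rot60_hexagon:
  assumes "x \<in> regular_hexagon"
  shows "rot60 x \<in> regular_hexagon"
proof -
  have "lin 1 0 (rot60 x) = lin 1 (-1) x / 2" "lin 1 1 (rot60 x) = 2 * lin 1 0 x"
    "lin 1 (-1) (rot60 x) = - lin 1 1 x"
    unfolding lin_rot60 by (simp_all add: lin_def field_simps)
  then show ?thesis using assms unfolding regular_hexagon_lin mem_Collect_eq abs_le_iff
    by (elim conjE, intro conjI; linarith)
qed

lemma flip_hexagon: "x \<in> regular_hexagon \<Longrightarrow> flip x \<in> regular_hexagon"
  unfolding regular_hexagon_lin mem_Collect_eq lin_flip by (simp add: lin_def abs_le_iff)

definition hexbody :: "(real^2) set \<Rightarrow> bool" where
  "hexbody K \<longleftrightarrow> unit_width K \<and> K \<subseteq> regular_hexagon"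

lemma hexbody_rot60: "hexbody K \<Longrightarrow> hexbody (rot60 ` K)"
  using unit_width_image[OF _ orthogonal_rot60, of K 0] rot60_hexagon by (auto simp: hexbody_def)

lemma hexbody_flip: "hexbody K \<Longrightarrow> hexbody (flip ` K)"
  using unit_width_image[OF _ orthogonal_flip, of K 0] flip_hexagon by (auto simp: hexbody_def)

text \<open>
  The slant is chosen such that the line of \<open>C+\<close> is \<open>lin (-1177) 377 x = 673\<close>; it is at distance \<open>1/2\<close> from
  the centre because \<open>1177\<^sup>2 + 3 * 377\<^sup>2 = 1346\<^sup>2\<close>. With \<open>A\<close> in direction 30 degrees, \<open>D+\<close>
  has coefficients \<open>(-1154, -400)\<close> and \<open>E+\<close> has \<open>(23, -777)\<close>; negating both coefficients gives the opposite
  corner, negating the second one gives the mirror images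
  \<open>C+ \<leftrightarrow> D-\<close>, \<open>D+ \<leftrightarrow> C-\<close>, \<open>E+ \<leftrightarrow> B-\<close>.
\<close>
definition avoids :: "(real^2) set \<Rightarrow> real \<Rightarrow> real \<Rightarrow> bool" where
  "avoids K a b \<longleftrightarrow> (\<forall>x\<in>K. lin a b x \<le> 673)"

lemma avoids_flip: "avoids (flip ` K) a b \<longleftrightarrow> avoids K a (- b)"
  by (simp add: avoids_def lin_flip)

lemma avoids_or_opposite:
  assumes "unit_width K" "a\<^sup>2 + 3 * b\<^sup>2 = 1346\<^sup>2"
  shows "avoids K a b \<or> avoids K (- a) (- b)"
  using unit_width_avoids_side[OF assms(1), of a b 673] assms(2) by (simp add: avoids_def)

text \<open>The avoided triangles are \<open>C+\<close> and \<open>E+\<close>; the alternatives are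
  \<open>A-\<close>, \<open>E-\<close>, and a contact point in the half of \<open>CD\<close> next to
  \<open>D\<close>.\<close>

definition placed :: "(real^2) set \<Rightarrow> bool" where
  "placed K \<longleftrightarrow> hexbody K \<and> avoids K (-1177) 377 \<and> avoids K 23 (-777) \<and>
     (avoids K 1177 377 \<or> avoids K (-23) (-777) \<or> (\<exists>q\<in>K. q$1 = -1/2 \<and> q$2 \<le> 0))"

text \<open>The unit chord normal to \<open>CD\<close> fits into the strip of width 1 only with its
  ends on the two sides.\<close>

lemma contact_CD:
  assumes "hexbody K"
  obtains q where "q \<in> K" "q$1 = -1/2"
proof -
  have "norm (vector [1, 0] :: real^2) = 1" by (simp add: norm_vec_def L2_set_def sum_2)
  then obtain q where q: "q \<in> K" "q + vector [1, 0] \<in> K"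
    using assms by (auto simp: hexbody_def unit_width_def)
  then have "q \<in> regular_hexagon" "q + vector [1, 0] \<in> regular_hexagon"
    using assms by (auto simp: hexbody_def)
  then have "q$1 = -1/2" by (auto simp: regular_hexagon_def abs_le_iff)
  with q that show thesis by blast
qed

lemma contact_DE:
  assumes "hexbody K"
  obtains q where "q \<in> K" "lin 1 1 q = -1"
proof -
  define n :: "real^2" where "n = vector [1/2, sqrt 3 / 2]"
  have "norm n = 1" by (simp add: n_def norm_vec_def L2_set_def sum_2 power_divide)
  then obtain q where q: "q \<in> K" "q + n \<in> K"
    using assms by (auto simp: hexbody_def unit_width_def)
  then have "q \<in> regular_hexagon" "q + n \<in> regular_hexagon"
    using assms by (auto simp: hexbody_def)
  moreover have "lin 1 1 (q + n) = lin 1 1 q + 2"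
    by (simp add: n_def lin_def algebra_simps)
  ultimately have "lin 1 1 q = -1" by (auto simp: regular_hexagon_lin abs_le_iff)
  with q that show thesis by blast
qed

lemma placement_avoiding:
  assumes K: "hexbody K" "avoids K (-1177) 377" "avoids K 23 (-777)"
  shows "placed K \<or> placed (flip ` K)"
proof (cases "avoids K 1177 377 \<or> avoids K (-23) (-777)")
  case True
  then show ?thesis using K by (auto simp: placed_def)
next
  case False
  have "unit_width K" using K(1) by (simp add: hexbody_def)
  \<comment> \<open>These are \<open>D-\<close> and \<open>B-\<close>, the mirror images of
    \<open>C+\<close> and \<open>E+\<close>, so the reflected body satisfies the hypotheses
    again.\<close>
  then have op: "avoids K (-1177) (-377)" "avoids K 23 777"
    using False avoids_or_opposite[of K 1177 377] avoids_or_opposite[of K "-23" "-777"] by auto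
  obtain q where q: "q \<in> K" "q$1 = -1/2" using contact_CD[OF K(1)] .
  show ?thesis
  proof (cases "q$2 \<le> 0")
    case True
    then show ?thesis using K q by (auto simp: placed_def)
  next
    case False
    then have "flip q $ 1 = -1/2 \<and> flip q $ 2 \<le> 0" using q by (simp add: flip_def)
    then have "\<exists>y\<in>flip ` K. y$1 = -1/2 \<and> y$2 \<le> 0" using q by blast
    moreover have "avoids (flip ` K) (-1177) 377" "avoids (flip ` K) 23 (-777)"
      using op by (auto simp: avoids_flip)
    ultimately have "placed (flip ` K)" using hexbody_flip[OF K(1)] unfolding placed_def by blast
    then show ?thesis ..
  qed
qed

text \<open>One \<open>+\<close> triangle of each opposite pair is avoided. Three corners, one from
  each opposite pair, always include two that are two steps apart, and a rotation by a multiple of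
  60 degrees takes these to \<open>C\<close> and \<open>E\<close>.\<close>

lemma placement:
  assumes K: "hexbody K"
  obtains R where "orthogonal_transformation R" "placed (R ` K)"
proof -
  have "unit_width K" using K by (simp add: hexbody_def)
  note op = avoids_or_opposite[OF this]
  have iter: "hexbody ((rot60 ^^ k) ` K) \<and> orthogonal_transformation (rot60 ^^ k)" for k
  proof (induction k)
    case 0
    then show ?case using K by (simp add: id_def)
  next
    case (Suc k)
    then have "hexbody (rot60 ` (rot60 ^^ k) ` K)" "orthogonal_transformation (rot60 \<circ> rot60 ^^ k)"
      using hexbody_rot60 orthogonal_transformation_compose[OF orthogonal_rot60] by blast+
    then show ?case by (simp add: image_comp comp_def)
  qed
  have step: "avoids ((rot60 ^^ Suc k) ` K) a b \<longleftrightarrow> avoids ((rot60 ^^ k) ` K) ((a + 3 * b) / 2) ((b - a) / 2)" for k a b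
    by (simp add: avoids_def lin_rot60)
  have "\<exists>k. avoids ((rot60 ^^ k) ` K) (-1177) 377 \<and> avoids ((rot60 ^^ k) ` K) 23 (-777)"
  proof (rule ccontr)
    assume no: "\<nexists>k. avoids ((rot60 ^^ k) ` K) (-1177) 377 \<and> avoids ((rot60 ^^ k) ` K) 23 (-777)"
    \<comment> \<open>\<open>a\<close> to \<open>f\<close> concern the \<open>+\<close> triangles at
      \<open>C, E\<close>; \<open>B, D\<close>; \<open>A, C\<close>; \<open>B, F\<close>;
      \<open>A, E\<close>; \<open>D, F\<close>: all pairs two steps apart.\<close>
    have a: "\<not> (avoids K (-1177) 377 \<and> avoids K 23 (-777))" using no[simplified, rule_format, of 0] by simp
    have b: "\<not> (avoids K (-23) 777 \<and> avoids K (-1154) (-400))"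
      using no[simplified, rule_format, of "Suc 0"] by (simp add: step del: funpow.simps(2))
    have c: "\<not> (avoids K 1154 400 \<and> avoids K (-1177) 377)"
      using no[simplified, rule_format, of 2] by (simp add: step numeral_eq_Suc del: funpow.simps(2))
    have d: "\<not> (avoids K 1177 (-377) \<and> avoids K (-23) 777)"
      using no[simplified, rule_format, of 3] by (simp add: step numeral_eq_Suc del: funpow.simps(2))
    have e: "\<not> (avoids K 23 (-777) \<and> avoids K 1154 400)"
      using no[simplified, rule_format, of 4] by (simp add: step numeral_eq_Suc del: funpow.simps(2))
    have f: "\<not> (avoids K (-1154) (-400) \<and> avoids K 1177 (-377))"
      using no[simplified, rule_format, of 5] by (simp add: step numeral_eq_Suc del: funpow.simps(2))
    show False using a b c d e f op[of 1177 "-377"] op[of 23 "-777"] op[of 1154 400] by auto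
  qed
  then obtain k where k: "placed ((rot60 ^^ k) ` K) \<or> placed (flip ` (rot60 ^^ k) ` K)"
    using placement_avoiding iter by blast
  have "orthogonal_transformation (flip \<circ> (rot60 ^^ k))"
    using orthogonal_transformation_compose[OF orthogonal_flip] iter by blast
  with k iter that show thesis by (auto simp: image_comp)
qed

text \<open>The line \<open>lin a b x = c\<close> is at distance at least 1 from \<open>q\<close>,
  and the body lies in the unit disc about \<open>q\<close>.\<close>

lemma lin_le_of_contact:
  assumes "unit_width K" "q \<in> K" "lin a b q \<le> d" "d \<le> c" "a\<^sup>2 + 3 * b\<^sup>2 \<le> (c - d)\<^sup>2" "x \<in> K"
  shows "lin a b x \<le> c"
proof -
  have "sqrt (a\<^sup>2 + 3 * b\<^sup>2) \<le> c - d" using assms by (intro real_le_lsqrt) auto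
  moreover have "dist x q \<le> 1" using assms by (auto simp: unit_width_def)
  ultimately show ?thesis using lin_le_add_norm[of x q a b] assms(3) by linarith
qed

section \<open>The polygonal cover\<close>

text \<open>
  Pairs stand for points in the coordinates \<open>(x$1, sqrt 3 * x$2)\<close>, in which all data are rational. An
  edge of a counterclockwise polygon has the polygon on its left.
\<close>

definition inner_side :: "(real \<times> real) \<times> (real \<times> real) \<Rightarrow> real^2 \<Rightarrow> bool" where
  "inner_side e x = (case e of ((p1, p2), (q1, q2)) \<Rightarrow>
     lin (q2 - p2) (p1 - q1) x \<le> (q2 - p2) * p1 + (p1 - q1) * p2)"

text \<open>
  The line through the edge does not meet the open unit disc about the point \<open>(X, -1 - X)\<close> of \<open>DE\<close>,
  respectively \<open>(-1/2, Y)\<close> of \<open>CD\<close>, and moving that point towards \<open>D\<close> preserves this.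
\<close>
definition tangent_DE :: "real \<Rightarrow> (real \<times> real) \<times> (real \<times> real) \<Rightarrow> bool" where
  "tangent_DE X e = (case e of ((p1, p2), (q1, q2)) \<Rightarrow>
     let a = q2 - p2; b = p1 - q1; c = a * p1 + b * p2; d = (a - b) * X - b
     in b \<le> a \<and> d \<le> c \<and> a\<^sup>2 + 3 * b\<^sup>2 \<le> (c - d)\<^sup>2)"

definition tangent_CD :: "real \<Rightarrow> (real \<times> real) \<times> (real \<times> real) \<Rightarrow> bool" where
  "tangent_CD Y e = (case e of ((p1, p2), (q1, q2)) \<Rightarrow>
     let a = q2 - p2; b = p1 - q1; c = a * p1 + b * p2; d = b * Y - a / 2
     in 0 \<le> b \<and> d \<le> c \<and> a\<^sup>2 + 3 * b\<^sup>2 \<le> (c - d)\<^sup>2)"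

lemma inner_side_tangent_DE:
  assumes "unit_width K" "q \<in> K" "lin 1 1 q = -1" "q$1 \<le> X" "tangent_DE X e" "x \<in> K"
  shows "inner_side e x"
proof -
  obtain p1 p2 q1 q2 where e: "e = ((p1, p2), (q1, q2))" by (metis surj_pair)
  define a b where ab: "a = q2 - p2" "b = p1 - q1"
  have t: "b \<le> a" "(a - b) * X - b \<le> a * p1 + b * p2"
    "a\<^sup>2 + 3 * b\<^sup>2 \<le> (a * p1 + b * p2 - ((a - b) * X - b))\<^sup>2"
    using assms(5) by (auto simp: tangent_DE_def e ab Let_def)
  have q: "sqrt 3 * q$2 = -1 - q$1" using assms(3) by (simp add: lin_def)
  have "lin a b q = (a - b) * q$1 - b" unfolding lin_def q by (simp add: algebra_simps)
  also have "\<dots> \<le> (a - b) * X - b" using t(1) assms(4) by (simp add: mult_left_mono)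
  finally show ?thesis
    using lin_le_of_contact[OF assms(1,2) _ t(2,3) assms(6)] by (simp add: inner_side_def e ab)
qed

lemma inner_side_tangent_CD:
  assumes "unit_width K" "q \<in> K" "q$1 = -1/2" "sqrt 3 * q$2 \<le> Y" "tangent_CD Y e" "x \<in> K"
  shows "inner_side e x"
proof -
  obtain p1 p2 q1 q2 where e: "e = ((p1, p2), (q1, q2))" by (metis surj_pair)
  define a b where ab: "a = q2 - p2" "b = p1 - q1"
  have t: "0 \<le> b" "b * Y - a / 2 \<le> a * p1 + b * p2"
    "a\<^sup>2 + 3 * b\<^sup>2 \<le> (a * p1 + b * p2 - (b * Y - a / 2))\<^sup>2"
    using assms(5) by (auto simp: tangent_CD_def e ab Let_def)
  have "lin a b q \<le> b * Y - a / 2"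
    using t(1) assms(3,4) by (simp add: lin_def mult_left_mono)
  then show ?thesis
    using lin_le_of_contact[OF assms(1,2) _ t(2,3) assms(6)] by (simp add: inner_side_def e ab)
qed

fun edges :: "'a list \<Rightarrow> ('a \<times> 'a) list" where
  "edges (p # q # r) = (p, q) # edges (q # r)"
| "edges _ = []"

lemma edges_append:
  "xs \<noteq> [] \<Longrightarrow> ys \<noteq> [] \<Longrightarrow> edges (xs @ ys) = edges xs @ (last xs, hd ys) # edges ys"
proof (induction xs rule: edges.induct)
  case ("2_2" v)
  then show ?case by (cases ys) auto
qed auto

lemma edges_split: "edges (xs @ y # ys) = edges (xs @ [y]) @ edges (y # ys)"
  by (induction xs rule: edges.induct) auto

text \<open>
  \<open>arc_FA\<close> approximates from outside the unit circle about the point of \<open>CD\<close> on the line of \<open>C+\<close>, and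
  \<open>arc_AB\<close> the one about the point of \<open>DE\<close> on the line of \<open>E+\<close>. The edge between them is tangent to the
  circle about the point of \<open>DE\<close> on the line of \<open>E-\<close> and passes just outside the intersection of the circle
  of \<open>arc_AB\<close> with the unit circle about the midpoint of \<open>CD\<close>.
\<close>
definition arc_FA :: "(real \<times> real) list" where
  "arc_FA =
    [(0.500000, 0.233307), (0.499891, 0.251344), (0.499672, 0.269478), (0.499343, 0.287608),
     (0.498904, 0.305730), (0.498356, 0.323843), (0.497699, 0.341946), (0.496932, 0.360035),
     (0.496055, 0.378110), (0.495070, 0.396167), (0.493975, 0.414206), (0.492772, 0.432224),
     (0.491459, 0.450219), (0.490038, 0.468190), (0.488322, 0.488313)]"

definition arc_AB :: "(real \<times> real) list" where
  "arc_AB =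
    [(0.450136, 0.540791), (0.444480, 0.547754), (0.434797, 0.559378), (0.425036, 0.570803),
     (0.415198, 0.582028), (0.405284, 0.593052), (0.395295, 0.603873), (0.385234, 0.614489),
     (0.375145, 0.624855)]"

text \<open>
  The vertex \<open>(0, -673/777)\<close> lies inside an edge; opposite to \<open>(0, 1)\<close>, it splits the fan
  of triangles about the centre into two half planes.
\<close>
definition flat_part :: "(real \<times> real) list" where
  "flat_part = [(0, 1), (-37/100, 63/100), (-1/2, 13/58), (-1/2, -1/2), (-13/100, -87/100),
     (0, -673/777), (4/29, -25/29), (1/2, -1/2)]"

definition cover_vertices :: "(real \<times> real) list" where
  "cover_vertices = flat_part @ arc_FA @ arc_AB @ [(0, 1)]"

definition cover :: "(real^2) set" where
  "cover = {x. \<forall>e\<in>set (edges cover_vertices). inner_side e x}"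

lemma tangents_FA: "\<forall>e\<in>set (edges arc_FA). tangent_CD (13/58) e"
  by (simp add: arc_FA_def tangent_CD_def Let_def power2_eq_square)

lemma tangents_AB: "\<forall>e\<in>set (edges arc_AB). tangent_DE (-13/100) e"
  by (simp add: arc_AB_def tangent_DE_def Let_def power2_eq_square)

lemma placed_subset_cover:
  assumes "placed K"
  shows "K \<subseteq> cover"
proof
  fix x assume x: "x \<in> K"
  have hex: "hexbody K" and C: "avoids K (-1177) 377" and E: "avoids K 23 (-777)"
    and alt: "avoids K 1177 377 \<or> avoids K (-23) (-777) \<or> (\<exists>q\<in>K. q$1 = -1/2 \<and> q$2 \<le> 0)"
    using assms by (auto simp: placed_def)
  have K: "unit_width K" using hex by (simp add: hexbody_def)
  have h: "\<bar>x$1\<bar> \<le> 1/2" "\<bar>x$1 + sqrt 3 * x$2\<bar> \<le> 1" "\<bar>x$1 - sqrt 3 * x$2\<bar> \<le> 1"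
    using hex x by (auto simp: hexbody_def regular_hexagon_def)
  have cuts: "-1177 * x$1 + 377 * (sqrt 3 * x$2) \<le> 673" "23 * x$1 - 777 * (sqrt 3 * x$2) \<le> 673"
    using C E x by (auto simp: avoids_def lin_def)
  obtain q where q: "q \<in> K" "lin 1 1 q = -1" using contact_DE[OF hex] .
  \<comment> \<open>The line of \<open>E+\<close> meets \<open>DE\<close> at
    \<open>(-13/100, -87/100)\<close>, that of \<open>C+\<close> meets \<open>CD\<close> at
    \<open>(-1/2, 13/58)\<close>; the contact points cannot lie beyond.\<close>
  have q1: "q$1 \<le> -13/100" using E q by (auto simp: avoids_def lin_def dest!: bspec)
  obtain r where r: "r \<in> K" "r$1 = -1/2" using contact_CD[OF hex] .
  have r2: "sqrt 3 * r$2 \<le> 13/58" using C r by (auto simp: avoids_def lin_def dest!: bspec)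
  have flat: "\<forall>e\<in>set (edges flat_part). inner_side e x"
    using h cuts by (simp add: flat_part_def inner_side_def lin_def) linarith
  have FA: "\<forall>e\<in>set (edges arc_FA). inner_side e x"
    using inner_side_tangent_CD[OF K r r2 _ x] tangents_FA by blast
  have AB: "\<forall>e\<in>set (edges arc_AB). inner_side e x"
    using inner_side_tangent_DE[OF K q q1 _ x] tangents_AB by blast
  \<comment> \<open>These two edges lie on the sides \<open>FA\<close> and
    \<open>AB\<close>.\<close>
  have ends: "inner_side (last flat_part, hd arc_FA) x" "inner_side (last arc_AB, (0, 1)) x"
    using h by (auto simp: flat_part_def arc_FA_def arc_AB_def inner_side_def lin_def)
  let ?e = "(last arc_FA, hd arc_AB)"
  have bridge: "inner_side ?e x"
    using alt
  proof (elim disjE)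
    assume "avoids K 1177 377"
    \<comment> \<open>All that this edge cuts off from the hexagon lies in
      \<open>A-\<close>.\<close>
    then have "1177 * x$1 + 377 * (sqrt 3 * x$2) \<le> 673" using x by (auto simp: avoids_def lin_def)
    then show ?thesis using h by (simp add: inner_side_def lin_def arc_FA_def arc_AB_def)
  next
    assume "avoids K (-23) (-777)"
    \<comment> \<open>The line of \<open>E-\<close> meets \<open>DE\<close> at
      \<open>(-4/29, -25/29)\<close>.\<close>
    then have "q$1 \<le> -4/29" using q by (auto simp: avoids_def lin_def dest!: bspec)
    moreover have "tangent_DE (-4/29) ?e"
      by (simp add: arc_FA_def arc_AB_def tangent_DE_def Let_def power2_eq_square)
    ultimately show ?thesis using inner_side_tangent_DE[OF K q] x by blast
  next
    assume "\<exists>q\<in>K. q$1 = -1/2 \<and> q$2 \<le> 0"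
    then obtain m where m: "m \<in> K" "m$1 = -1/2" "m$2 \<le> 0" by auto
    \<comment> \<open>the bridging edge is a positive combination of a tangent of each of the two discs\<close>
    have "inner_side ((0.450136, 0.540791), (0.444480, 0.547754)) x"
      using AB by (simp add: arc_AB_def)
    \<comment> \<open>Coefficients and bound are those of the bridging edge minus 13/2 times those
      of the first edge of \<open>arc_AB\<close>. What remains is nearly tangent to the unit disc
      about the midpoint of \<open>CD\<close>; a lower contact point only decreases
      \<open>lin\<close>.\<close>
    moreover have "lin 0.0072185 0.001422 x \<le> 40183115180/10000000000000"
    proof (rule lin_le_of_contact[OF K m(1) _ _ _ x])
      have "sqrt 3 * m$2 \<le> 0" using m by (simp add: mult_nonneg_nonpos)
      then show "lin 0.0072185 0.001422 m \<le> -0.00360925" using m by (simp add: lin_def)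
    qed (simp_all add: power2_eq_square)
    ultimately show ?thesis by (simp add: inner_side_def lin_def arc_FA_def arc_AB_def)
  qed
  have "edges cover_vertices = edges flat_part @ (last flat_part, hd arc_FA) # edges arc_FA @
      ?e # edges arc_AB @ [(last arc_AB, (0, 1))]"
    by (simp add: cover_vertices_def edges_append flat_part_def arc_FA_def arc_AB_def)
  with flat FA AB ends bridge show "x \<in> cover" by (auto simp: cover_def)
qed

section \<open>Convexity and area of the cover\<close>

lemma inner_side_halfspace: "\<exists>a b. {x. inner_side e x} = {x. a \<bullet> x \<le> b}"
proof -
  obtain p1 p2 q1 q2 where "e = ((p1, p2), (q1, q2))" by (metis surj_pair)
  then have "{x. inner_side e x} = {x. vector [q2 - p2, sqrt 3 * (p1 - q1)] \<bullet> x \<le> (q2 - p2) * p1 + (p1 - q1) * p2}"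
    by (simp add: inner_side_def lin_def inner_vec_def sum_2 mult_ac)
  then show ?thesis by blast
qed

lemma cover_eq_INT: "cover = (\<Inter>e\<in>set (edges cover_vertices). {x. inner_side e x})"
  by (auto simp: cover_def)

lemma convex_cover: "convex cover"
  unfolding cover_eq_INT by (intro convex_INT) (metis inner_side_halfspace convex_halfspace_le)

lemma closed_cover: "closed cover"
  unfolding cover_eq_INT by (intro closed_INT) (metis inner_side_halfspace closed_halfspace_le)

definition pt :: "real \<times> real \<Rightarrow> real^2" where
  "pt p = vector [fst p, snd p / sqrt 3]"

definition cross2 :: "real \<times> real \<Rightarrow> real \<times> real \<Rightarrow> real" where
  "cross2 p q = fst p * snd q - snd p * fst q"

definition fan_triangle :: "(real \<times> real) \<times> (real \<times> real) \<Rightarrow> (real^2) set" where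
  "fan_triangle e = convex hull {0, pt (fst e), pt (snd e)}"

lemma emeasure_triangle: "emeasure lebesgue (fan_triangle e) = ennreal (\<bar>cross2 (fst e) (snd e)\<bar> / (2 * sqrt 3))"
proof -
  have "compact (fan_triangle e)" unfolding fan_triangle_def by (intro finite_imp_compact_convex_hull) auto
  then have b: "fan_triangle e \<in> sets borel" "emeasure lborel (fan_triangle e) < \<infinity>"
    using emeasure_compact_finite by (auto intro: borel_compact)
  then have "emeasure lebesgue (fan_triangle e) = ennreal (measure lborel (fan_triangle e))"
    by (simp add: emeasure_eq_ennreal_measure less_top)
  also have "measure lborel (fan_triangle e) = \<bar>cross2 (fst e) (snd e)\<bar> / (2 * sqrt 3)"
    unfolding fan_triangle_def content_triangle
    by (simp add: pt_def cross2_def abs_minus_commute mult.commute flip: diff_divide_distrib)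
  finally show ?thesis .
qed

text \<open>By Cramer's rule \<open>v\<close> and \<open>w\<close> are the coordinates of
  \<open>x\<close> in the basis \<open>p, q\<close>; the signs make them nonnegative, and the edge
  inequality says \<open>v + w \<le> 1\<close>.\<close>

lemma mem_triangle:
  assumes D: "cross2 p q > 0" and x: "cross2 p (x$1, sqrt 3 * x$2) \<ge> 0" "cross2 q (x$1, sqrt 3 * x$2) \<le> 0"
    and "inner_side (p, q) x"
  shows "x \<in> fan_triangle (p, q)"
proof -
  define v w where vw: "v = - cross2 q (x$1, sqrt 3 * x$2) / cross2 p q" "w = cross2 p (x$1, sqrt 3 * x$2) / cross2 p q"
  have "v \<ge> 0" "w \<ge> 0" using D x by (auto simp: vw divide_nonpos_pos)
  moreover have "v + w \<le> 1"
  proof -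
    have "- cross2 q (x$1, sqrt 3 * x$2) + cross2 p (x$1, sqrt 3 * x$2) \<le> cross2 p q"
      using assms(4) by (cases p; cases q) (simp add: inner_side_def cross2_def lin_def algebra_simps)
    then show ?thesis using D by (simp add: vw flip: add_divide_distrib diff_divide_distrib)
  qed
  moreover have "x = v *\<^sub>R pt p + w *\<^sub>R pt q"
  proof -
    have "cross2 p q * x$1 = - cross2 q (x$1, sqrt 3 * x$2) * fst p + cross2 p (x$1, sqrt 3 * x$2) * fst q"
      by (simp add: cross2_def algebra_simps)
    then have "x$1 = v * fst p + w * fst q" using D by (simp add: vw field_simps)
    moreover have "cross2 p q * (sqrt 3 * x$2) = - cross2 q (x$1, sqrt 3 * x$2) * snd p + cross2 p (x$1, sqrt 3 * x$2) * snd q"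
      by (simp add: cross2_def algebra_simps)
    then have "sqrt 3 * x$2 = v * snd p + w * snd q" using D by (simp add: vw field_simps)
    ultimately show ?thesis by (simp add: vec_eq_iff forall_2 pt_def field_simps)
  qed
  ultimately show ?thesis unfolding fan_triangle_def convex_hull_3 fst_conv snd_conv mem_Collect_eq
    by (intro exI[of _ "1 - v - w"] exI[of _ v] exI[of _ w]) auto
qed

text \<open>A discrete intermediate value theorem, used to find the edge whose sector seen from the
  centre contains a given point.\<close>

lemma edges_sign_change:
  fixes f :: "'a \<Rightarrow> real"
  assumes "f p \<ge> 0" "f (last (q # vs)) \<le> 0"
  shows "\<exists>(a, b)\<in>set (edges (p # q # vs)). f a \<ge> 0 \<and> f b \<le> 0"
  using assms
proof (induction vs arbitrary: p q)
  case (Cons a vs)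
  show ?case
  proof (cases "f q \<le> 0")
    case False
    then show ?thesis using Cons.IH[of q a] Cons.prems by auto
  qed (use Cons.prems in auto)
qed auto

lemma cross2_edges_pos: "\<forall>(p, q)\<in>set (edges cover_vertices). cross2 p q > 0"
  by (simp add: cover_vertices_def flat_part_def arc_FA_def arc_AB_def cross2_def)

lemma cover_subset_triangles: "cover \<subseteq> (\<Union>e\<in>set (edges cover_vertices). fan_triangle e)"
proof
  fix x assume x: "x \<in> cover"
  define f where "f p = cross2 p (x$1, sqrt 3 * x$2)" for p
  let ?G = "(0, -673/777)" and ?left = "[(-37/100, 63/100), (-1/2, 13/58), (-1/2, -1/2), (-13/100, -87/100)]"
  let ?right = "(4/29, -25/29) # (1/2, -1/2) # arc_FA @ arc_AB @ [(0, 1)]"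
  have "cover_vertices = ((0, 1) # ?left) @ ?G # ?right"
    by (simp add: cover_vertices_def flat_part_def)
  then have split: "edges cover_vertices = edges ((0, 1) # ?left @ [?G]) @ edges (?G # ?right)"
    by (metis edges_split append_Cons)
  have "\<exists>(p, q)\<in>set (edges cover_vertices). f p \<ge> 0 \<and> f q \<le> 0"
  \<comment> \<open>\<open>f (0, 1)\<close> is \<open>- x$1\<close> and \<open>f ?G\<close> is a
    positive multiple of \<open>x$1\<close>, so on each half of the boundary the end values have the
    required signs.\<close>
  proof (cases "x$1 \<le> 0")
    case True
    then have "\<exists>(p, q)\<in>set (edges ((0, 1) # ?left @ [?G])). f p \<ge> 0 \<and> f q \<le> 0"
      unfolding append_Cons by (intro edges_sign_change) (auto simp: f_def cross2_def)
    then show ?thesis unfolding split set_append by blast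
  next
    case False
    then have "\<exists>(p, q)\<in>set (edges (?G # ?right)). f p \<ge> 0 \<and> f q \<le> 0"
      by (intro edges_sign_change) (auto simp: f_def cross2_def)
    then show ?thesis unfolding split set_append by blast
  qed
  then obtain p q where pq: "(p, q) \<in> set (edges cover_vertices)" "f p \<ge> 0" "f q \<le> 0" by auto
  have "x \<in> fan_triangle (p, q)"
    by (rule mem_triangle) (use pq cross2_edges_pos x in \<open>auto simp: f_def cover_def\<close>)
  with pq show "x \<in> (\<Union>e\<in>set (edges cover_vertices). fan_triangle e)" by blast
qed

lemma emeasure_triangles_le:
  "emeasure lebesgue (\<Union>e\<in>set es. fan_triangle e) \<le> ennreal (sum_list (map (\<lambda>(p, q). \<bar>cross2 p q\<bar>) es) / (2 * sqrt 3))"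
proof (induction es)
  case (Cons e es)
  have m: "fan_triangle e \<in> sets lebesgue" for e
    unfolding fan_triangle_def by (intro lmeasurable_compact fmeasurableD finite_imp_compact_convex_hull) auto
  have "emeasure lebesgue (\<Union>e\<in>set (e # es). fan_triangle e) \<le>
      emeasure lebesgue (fan_triangle e) + emeasure lebesgue (\<Union>e\<in>set es. fan_triangle e)"
    using emeasure_subadditive[OF m[of e], of "\<Union>e\<in>set es. fan_triangle e"] m
    by (simp add: sets.finite_UN)
  also have "\<dots> \<le> ennreal (\<bar>cross2 (fst e) (snd e)\<bar> / (2 * sqrt 3)) +
      ennreal (sum_list (map (\<lambda>(p, q). \<bar>cross2 p q\<bar>) es) / (2 * sqrt 3))"
    using Cons by (intro add_mono) (auto simp: emeasure_triangle)
  also have "\<dots> = ennreal (sum_list (map (\<lambda>(p, q). \<bar>cross2 p q\<bar>) (e # es)) / (2 * sqrt 3))"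
  proof -
    have "sum_list (map (\<lambda>(p, q). \<bar>cross2 p q\<bar>) es) \<ge> 0" by (intro sum_list_nonneg) auto
    then show ?thesis by (simp add: case_prod_beta add_divide_distrib flip: ennreal_plus)
  qed
  finally show ?case .
qed auto

lemma emeasure_cover: "emeasure lebesgue cover \<le> ennreal 0.8441153"
proof -
  \<comment> \<open>The shoelace sum: in the scaled coordinates, \<open>2 * sqrt 3\<close> times the
    total area of the triangles.\<close>
  have S: "sum_list (map (\<lambda>(p, q). \<bar>cross2 p q\<bar>) (edges cover_vertices)) = 16959777511881/5800000000000"
    by (simp add: cover_vertices_def flat_part_def arc_FA_def arc_AB_def cross2_def)
  have "1.732050 \<le> sqrt 3" by (rule real_le_rsqrt) (simp add: power2_eq_square)
  then have "(16959777511881/5800000000000) / (2 * sqrt 3) \<le> 0.8441153"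
    by (simp add: field_simps)
  with S have "sum_list (map (\<lambda>(p, q). \<bar>cross2 p q\<bar>) (edges cover_vertices)) / (2 * sqrt 3) \<le> 0.8441153"
    by metis
  have "emeasure lebesgue cover \<le> emeasure lebesgue (\<Union>e\<in>set (edges cover_vertices). fan_triangle e)"
  proof (rule emeasure_mono[OF cover_subset_triangles])
    show "(\<Union>e\<in>set (edges cover_vertices). fan_triangle e) \<in> sets lebesgue" unfolding fan_triangle_def
      by (intro sets.finite_UN lmeasurable_compact fmeasurableD finite_imp_compact_convex_hull) auto
  qed
  also have "\<dots> \<le> ennreal (sum_list (map (\<lambda>(p, q). \<bar>cross2 p q\<bar>) (edges cover_vertices)) / (2 * sqrt 3))"
    by (rule emeasure_triangles_le)
  also have "\<dots> \<le> ennreal 0.8441153" by (rule ennreal_leI) fact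
  finally show ?thesis .
qed

theorem mainTheorem1:
  shows "\<exists>U. universal_covering U \<and> U \<in> sets lebesgue \<and>
           emeasure lebesgue U \<le> ennreal 0.8441153"
proof (intro exI[of _ cover] conjI)
  show "cover \<in> sets lebesgue" using closed_cover by (simp add: lebesgue_closedin borel_closed)
  show "emeasure lebesgue cover \<le> ennreal 0.8441153" by (rule emeasure_cover)
  have "\<exists>f. plane_isometry f \<and> f ` A \<subseteq> cover" if A: "diam A = 1" for A
  proof -
    have "\<forall>x\<in>A. \<forall>y\<in>A. dist x y \<le> 1"
    proof (intro ballI)
      fix x y assume "x \<in> A" "y \<in> A"
      then have "ereal (dist x y) \<le> diam A"
        unfolding diam_def by (intro SUP_upper2[of "(x, y)"]) auto
      then show "dist x y \<le> 1" using A by simp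
    qed
    \<comment> \<open>The supremum over the empty set is minus infinity in \<open>ereal\<close>, not
      1.\<close>
    moreover have "A \<noteq> {}" using A by (auto simp: diam_def bot_ereal_def)
    ultimately obtain K where K: "A \<subseteq> K" "unit_width K" by (rule unit_width_extension)
    obtain R z where R: "orthogonal_transformation R" "(\<lambda>x. R (x - z)) ` K \<subseteq> regular_hexagon"
      using circumscribed_regular_hexagon[OF K(2)] .
    have "hexbody ((\<lambda>x. R (x - z)) ` K)"
      using R unit_width_image[OF K(2) R(1)] by (simp add: hexbody_def)
    then obtain S where S: "orthogonal_transformation S" "placed (S ` (\<lambda>x. R (x - z)) ` K)"
      by (rule placement)
    have "plane_isometry ((\<lambda>x. S (x - 0)) \<circ> (\<lambda>x. R (x - z)))"
      using S(1) R(1) by (intro plane_isometry_comp plane_isometry_rigid)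
    moreover have "((\<lambda>x. S (x - 0)) \<circ> (\<lambda>x. R (x - z))) ` A \<subseteq> cover"
      using placed_subset_cover[OF S(2)] K(1) by auto
    ultimately show ?thesis by blast
  qed
  then show "universal_covering cover" using convex_cover by (simp add: universal_covering_def)
qed

end
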